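(* Let $(X_1,p_1,\Gamma)$ be an $F_1$-graph bundle and $(X_2,p_2,\Gamma)$ an $F_2$-graph bundle over the same graph $\Gamma$, and let $f:\Gamma'\to\Gamma$ be a morphism of graphs. Then the graph bundles over $\Gamma'$ $$f^*(X_1\boxplus X_2,(p_1,p_2),\Gamma)\quad\text{and}\quad f^*(X_1,p_1,\Gamma)\boxplus f^*(X_2,p_2,\Gamma)$$ are equivalent.
   Context: Graphs are simple and undirected: $\Gamma=(V_\Gamma,E_\Gamma)$ with $E_\Gamma$ a set of unordered pairs of distinct vertices; $v\sim w$ means $\{v,w\}\in E_\Gamma$. A morphism of graphs $f:\Gamma_1\to\Gamma_2$ is a function $f:V_{\Gamma_1}\to V_{\Gamma_2}$ such that $v\sim w$ implies $f(v)\sim f(w)$ or $f(v)=f(w)$; it is surjective if it is surjective on vertices. An isomorphism of graphs is a bijection on vertices with $v\sim w$ iff $f(v)\sim f(w)$. The neighborhood $N(v)$ of a vertex $v$ is the graph with vertices $v$ and all $w\sim v$, and edges $\{v,w\}$ for $w\sim v$. For a natural number $k$, a triple $(\widetilde\Gamma,p,\Gamma)$ with $p:\widetilde\Gamma\to\Gamma$ a surjective morphism of graphs is a $k$-fold covering if each $p^{-1}(v)$ has exactly $k$ vertices and, for each vertex $x$ of $\widetilde\Gamma$, $p$ restricts to an isomorphism $N(x)\to N(p(x))$. For $v\sim w$ in $\Gamma$ the covering induces a bijection $\psi_{vw}:p^{-1}(v)\to p^{-1}(w)$ sending $x$ to the unique neighbour of $x$ in $\widetilde\Gamma$ lying over $w$.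 Graph bundles. Let $p:X\to\Gamma$ be a surjective morphism of graphs. The fiber $p^{-1}(v)$ is the subgraph of $X$ induced on the preimage of $v$. Let $\widetilde X$ be the graph with vertex set $V_X$ whose edges are the edges $\{x,y\}$ of $X$ with $p(x)\ne p(y)$, and let $\widetilde p:\widetilde X\to\Gamma$ be the map $p$. Given a graph $F$, $(X,p,\Gamma)$ is an $F$-graph bundle if (1) each fiber $p^{-1}(v)$ is isomorphic to $F$; (2) $\widetilde p:\widetilde X\to\Gamma$ is a $|V_F|$-fold covering; (3) for all $v\sim w$ in $\Gamma$ the bijection $\psi_{vw}:p^{-1}(v)\to p^{-1}(w)$ induced by this covering is an isomorphism of graphs. Two graph bundles $(X,p,\Gamma)$, $(Y,q,\Gamma)$ over the same base are equivalent if there is an isomorphism of graphs $\Phi:X\to Y$ with $q\circ\Phi=p$. Pullback. For a morphism $f:\Gamma'\to\Gamma$ and a graph bundle $(X,p,\Gamma)$, the pullback $f^*(X,p,\Gamma)=(f^*X,f^*p,\Gamma')$ has $V_{f^*X}=\{(v,x)\in V_{\Gamma'}\times V_X: f(v)=p(x)\}$, with $(v,x)\sim(w,y)$ iff one of: (I) $v=w$ and $x\sim y$; (II) $v\sim w$, $f(v)=f(w)$ and $x=y$; (III) $v\sim w$, $f(v)\sim f(w)$ and $x\sim y$. The projection is $f^*p(v,x)=v$. Subdirect product. For graph bundles $(X_1,p_1,\Gamma)$, $(X_2,p_2,\Gamma)$, the subdirect product $(X_1,p_1,\Gamma)\boxplus(X_2,p_2,\Gamma)$ is $(X_1\boxplus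 X_2,(p_1,p_2),\Gamma)$, where $X_1\boxplus X_2$ is the total space of the pullback $p_1^*(X_2,p_2,\Gamma)$ (so its vertices are the pairs $(x,y)\in V_{X_1}\times V_{X_2}$ with $p_1(x)=p_2(y)$) and $(p_1,p_2)(x,y)=p_1(x)=p_2(y)$. *)

theory Defs
  imports Main
begin

record 'a ugraph =
  verts :: "'a set"
  edges :: "'a set set"

definition simple_graph :: "'a ugraph \<Rightarrow> bool" where
  "simple_graph G \<longleftrightarrow>
     (\<forall>e\<in>edges G. \<exists>v w. v \<in> verts G \<and> w \<in> verts G \<and> v \<noteq> w \<and> e = {v, w})"

definition adj :: "'a ugraph \<Rightarrow> 'a \<Rightarrow> 'a \<Rightarrow> bool" where
  "adj G v w \<longleftrightarrow> {v, w} \<in> edges G"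

text \<open>Maps between graphs are HOL functions of which only the values on the vertex set of the
  source matter.\<close>

definition graph_morphism :: "('a \<Rightarrow> 'b) \<Rightarrow> 'a ugraph \<Rightarrow> 'b ugraph \<Rightarrow> bool" where
  "graph_morphism f G H \<longleftrightarrow>
     simple_graph G \<and> simple_graph H \<and> f ` verts G \<subseteq> verts H \<and>
     (\<forall>v w. adj G v w \<longrightarrow> adj H (f v) (f w) \<or> f v = f w)"

definition surj_graph_morphism :: "('a \<Rightarrow> 'b) \<Rightarrow> 'a ugraph \<Rightarrow> 'b ugraph \<Rightarrow> bool" where
  "surj_graph_morphism f G H \<longleftrightarrow> graph_morphism f G H \<and> f ` verts G = verts H"

definition graph_iso :: "('a \<Rightarrow> 'b) \<Rightarrow> 'a ugraph \<Rightarrow> 'b ugraph \<Rightarrow> bool" where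
  "graph_iso f G H \<longleftrightarrow>
     simple_graph G \<and> simple_graph H \<and> bij_betw f (verts G) (verts H) \<and>
     (\<forall>v\<in>verts G. \<forall>w\<in>verts G. adj G v w \<longleftrightarrow> adj H (f v) (f w))"

text \<open>The neighborhood is a star: edges between two neighbours of \<open>v\<close> are left out.\<close>

definition neighborhood :: "'a ugraph \<Rightarrow> 'a \<Rightarrow> 'a ugraph" where
  "neighborhood G v =
     \<lparr>verts = insert v {w. adj G v w}, edges = {{v, w} | w. adj G v w}\<rparr>"

text \<open>Finiteness is required separately because \<open>card\<close> of an infinite set is \<open>0\<close>.\<close>

definition covering :: "nat \<Rightarrow> 'x ugraph \<Rightarrow> ('x \<Rightarrow> 'b) \<Rightarrow> 'b ugraph \<Rightarrow> bool" where
  "covering k X p G \<longleftrightarrow>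
     surj_graph_morphism p X G \<and>
     (\<forall>v\<in>verts G. finite {x \<in> verts X. p x = v} \<and> card {x \<in> verts X. p x = v} = k) \<and>
     (\<forall>x\<in>verts X. graph_iso p (neighborhood X x) (neighborhood G (p x)))"

text \<open>The map \<open>\<psi>\<^sub>v\<^sub>w\<close> induced by a covering \<open>p : X \<rightarrow> G\<close>. The vertex \<open>v\<close> is not an argument: it is
  \<open>p x\<close>. The description is meaningful when \<open>p x\<close> is adjacent to \<open>w\<close>.\<close>

definition covering_transport :: "'x ugraph \<Rightarrow> ('x \<Rightarrow> 'b) \<Rightarrow> 'b \<Rightarrow> 'x \<Rightarrow> 'x" where
  "covering_transport X p w x = (THE y. y \<in> verts X \<and> adj X x y \<and> p y = w)"

definition induced_subgraph :: "'a ugraph \<Rightarrow> 'a set \<Rightarrow> 'a ugraph" where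
  "induced_subgraph G S = \<lparr>verts = S, edges = {e \<in> edges G. e \<subseteq> S}\<rparr>"

definition fiber :: "'x ugraph \<Rightarrow> ('x \<Rightarrow> 'b) \<Rightarrow> 'b \<Rightarrow> 'x ugraph" where
  "fiber X p v = induced_subgraph X {x \<in> verts X. p x = v}"

definition cross_graph :: "'x ugraph \<Rightarrow> ('x \<Rightarrow> 'b) \<Rightarrow> 'x ugraph" where
  "cross_graph X p =
     \<lparr>verts = verts X, edges = {{x, y} | x y. adj X x y \<and> p x \<noteq> p y}\<rparr>"

type_synonym ('x, 'b) bundle_triple = "'x ugraph \<times> ('x \<Rightarrow> 'b) \<times> 'b ugraph"

text \<open>\<open>F\<close> is finite because \<open>k\<close>-fold coverings are only defined for natural numbers \<open>k\<close>, and here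
  \<open>k = |V\<^sub>F|\<close>.\<close>

fun fiber_bundle :: "'f ugraph \<Rightarrow> ('x, 'b) bundle_triple \<Rightarrow> bool" where
  "fiber_bundle F (X, p, G) \<longleftrightarrow>
     simple_graph F \<and> finite (verts F) \<and>
     surj_graph_morphism p X G \<and>
     (\<forall>v\<in>verts G. \<exists>\<phi>. graph_iso \<phi> (fiber X p v) F) \<and>
     covering (card (verts F)) (cross_graph X p) p G \<and>
     (\<forall>v w. adj G v w \<longrightarrow>
        graph_iso (covering_transport (cross_graph X p) p w) (fiber X p v) (fiber X p w))"

text \<open>A graph bundle is an \<open>F\<close>-graph bundle for some \<open>F\<close>. Taking the vertices of \<open>F\<close> in the type
  of the vertices of the total space loses no generality: if the base has a vertex \<open>v\<close>, then
  \<open>F\<close> can be replaced by the fiber over \<open>v\<close>, and over the empty base by the empty graph.\<close>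

definition graph_bundle :: "('x, 'b) bundle_triple \<Rightarrow> bool" where
  "graph_bundle \<xi> \<longleftrightarrow> (\<exists>F :: 'x ugraph. fiber_bundle F \<xi>)"

lemma graph_iso_sym:
  assumes "graph_iso f G H"
  shows "graph_iso (inv_into (verts G) f) H G"
proof -
  have b: "bij_betw f (verts G) (verts H)" using assms by (simp add: graph_iso_def)
  note i = bij_betw_inv_into[OF b]
  have "adj H v w \<longleftrightarrow> adj G (inv_into (verts G) f v) (inv_into (verts G) f w)"
    if "v \<in> verts H" "w \<in> verts H" for v w
    using assms that bij_betw_apply[OF i] bij_betw_inv_into_right[OF b]
    by (simp add: graph_iso_def)
  with i assms show ?thesis by (simp add: graph_iso_def)
qed

lemma graph_iso_trans:
  assumes "graph_iso f G H" "graph_iso g H K"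
  shows "graph_iso (g \<circ> f) G K"
  using assms unfolding graph_iso_def
  by (auto intro: bij_betw_trans simp: bij_betwE)

lemma fiber_bundle_imp_graph_bundle:
  assumes "fiber_bundle F (X, p, G)"
  shows "graph_bundle (X, p, G)"
proof (cases "verts G = {}")
  case True
  with assms have "edges G = {}"
    by (auto simp: surj_graph_morphism_def graph_morphism_def simple_graph_def)
  with True assms have "fiber_bundle \<lparr>verts = {}, edges = {}\<rparr> (X, p, G)"
    by (auto simp: covering_def simple_graph_def adj_def)
  then show ?thesis by (auto simp: graph_bundle_def)
next
  case False
  then obtain v where v: "v \<in> verts G" by auto
  with assms obtain \<phi> where \<phi>: "graph_iso \<phi> (fiber X p v) F" by auto
  have vf: "verts (fiber X p v) = {x \<in> verts X. p x = v}"
    by (simp add: fiber_def induced_subgraph_def)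
  have "card (verts (fiber X p v)) = card (verts F)"
    using \<phi> by (auto simp: graph_iso_def bij_betw_same_card)
  moreover have "finite (verts (fiber X p v))"
    using \<phi> assms by (auto simp: graph_iso_def bij_betw_finite)
  moreover have "simple_graph (fiber X p v)"
    using \<phi> by (simp add: graph_iso_def)
  moreover have "\<exists>\<psi>. graph_iso \<psi> (fiber X p w) (fiber X p v)" if "w \<in> verts G" for w
  proof -
    from that assms obtain \<chi> where "graph_iso \<chi> (fiber X p w) F" by auto
    from graph_iso_trans[OF this graph_iso_sym[OF \<phi>]] show ?thesis by blast
  qed
  ultimately have "fiber_bundle (fiber X p v) (X, p, G)"
    using assms by simp
  then show ?thesis by (auto simp: graph_bundle_def)
qed

text \<open>Equivalence relates graph bundles, so it includes that both triples are graph bundles.\<close>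

fun bundle_equivalent :: "('x, 'b) bundle_triple \<Rightarrow> ('y, 'b) bundle_triple \<Rightarrow> bool" where
  "bundle_equivalent (X, p, G) (Y, q, H) \<longleftrightarrow>
     graph_bundle (X, p, G) \<and> graph_bundle (Y, q, H) \<and> G = H \<and>
     (\<exists>\<Phi>. graph_iso \<Phi> X Y \<and> (\<forall>x\<in>verts X. q (\<Phi> x) = p x))"

definition pullback_verts ::
    "'c ugraph \<Rightarrow> ('c \<Rightarrow> 'b) \<Rightarrow> 'x ugraph \<Rightarrow> ('x \<Rightarrow> 'b) \<Rightarrow> ('c \<times> 'x) set" where
  "pullback_verts G' f X p = {(v, x). v \<in> verts G' \<and> x \<in> verts X \<and> f v = p x}"

text \<open>\<open>pullback G' f (X, p, G)\<close> is the pullback along \<open>f : G' \<rightarrow> G\<close>.\<close>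

fun pullback :: "'c ugraph \<Rightarrow> ('c \<Rightarrow> 'b) \<Rightarrow> ('x, 'b) bundle_triple \<Rightarrow> ('c \<times> 'x, 'c) bundle_triple" where
  "pullback G' f (X, p, G) =
     (\<lparr>verts = pullback_verts G' f X p,
       edges = {{(v, x), (w, y)} | v x w y.
          (v, x) \<in> pullback_verts G' f X p \<and> (w, y) \<in> pullback_verts G' f X p \<and>
          (v = w \<and> adj X x y \<or>
           adj G' v w \<and> f v = f w \<and> x = y \<or>
           adj G' v w \<and> adj G (f v) (f w) \<and> adj X x y)}\<rparr>,
      fst, G')"

lemma adj_pullback:
  "adj (fst (pullback G' f (X, p, G))) (v, x) (w, y) \<longleftrightarrow>
    (v, x) \<in> pullback_verts G' f X p \<and> (w, y) \<in> pullback_verts G' f X p \<and>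
    (v = w \<and> adj X x y \<or>
     adj G' v w \<and> f v = f w \<and> x = y \<or>
     adj G' v w \<and> adj G (f v) (f w) \<and> adj X x y)"
  by (auto simp: adj_def doubleton_eq_iff insert_commute)

text \<open>Meant for two bundles over the same base.\<close>

fun subdirect_product ::
    "('x, 'b) bundle_triple \<Rightarrow> ('y, 'b) bundle_triple \<Rightarrow> ('x \<times> 'y, 'b) bundle_triple" where
  "subdirect_product (X\<^sub>1, p\<^sub>1, G) (X\<^sub>2, p\<^sub>2, H) =
     (fst (pullback X\<^sub>1 p\<^sub>1 (X\<^sub>2, p\<^sub>2, H)), \<lambda>(x, y). p\<^sub>1 x, G)"

end

theory Submission
  imports Defs
begin

text \<open>For the projection \<open>p\<close> of a graph bundle, being a covering off the fibers with transports
  that are isomorphisms means: every edge of the base has a unique lift at each vertex above its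
  end, and lifts of one edge match up the edges of the two fibers. In this form the bundle axioms
  pass to pullbacks and subdirect products vertex by vertex. The equivalence is
  \<open>(v, (x, y)) \<mapsto> ((v, x), (v, y))\<close>; as no vertex is adjacent to itself, the mixed cases of
  the edge conditions (I), (II), (III) on the two sides are empty, and the others agree.\<close>

section \<open>Adjacency in fibers and in the graph of edges between fibers\<close>

lemma adj_commute: "adj G v w \<longleftrightarrow> adj G w v"
  by (simp add: adj_def insert_commute)

lemma simple_graph_adjD:
  assumes "simple_graph G" "adj G v w"
  shows "v \<in> verts G" "w \<in> verts G" "v \<noteq> w"
  using assms unfolding simple_graph_def adj_def by (fastforce simp: doubleton_eq_iff)+

lemma adj_induced_subgraph: "adj (induced_subgraph G S) v w \<longleftrightarrow> adj G v w \<and> v \<in> S \<and> w \<in> S"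
  by (auto simp: adj_def induced_subgraph_def)

lemma simple_graph_induced_subgraph:
  assumes "simple_graph G"
  shows "simple_graph (induced_subgraph G S)"
  using assms unfolding simple_graph_def induced_subgraph_def by fastforce

lemma verts_fiber [simp]: "verts (fiber X p v) = {x \<in> verts X. p x = v}"
  by (simp add: fiber_def induced_subgraph_def)

lemma adj_fiber [simp]:
  "adj (fiber X p v) x y \<longleftrightarrow> adj X x y \<and> x \<in> verts X \<and> p x = v \<and> y \<in> verts X \<and> p y = v"
  by (auto simp: fiber_def adj_induced_subgraph)

lemma simple_graph_fiber: "simple_graph X \<Longrightarrow> simple_graph (fiber X p v)"
  by (simp add: fiber_def simple_graph_induced_subgraph)

lemma verts_cross_graph [simp]: "verts (cross_graph X p) = verts X"
  by (simp add: cross_graph_def)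

lemma adj_cross_graph [simp]: "adj (cross_graph X p) x y \<longleftrightarrow> adj X x y \<and> p x \<noteq> p y"
  by (auto simp: cross_graph_def adj_def doubleton_eq_iff insert_commute)

lemma simple_graph_cross_graph:
  assumes "simple_graph X"
  shows "simple_graph (cross_graph X p)"
  using simple_graph_adjD[OF assms] unfolding simple_graph_def[of "cross_graph X p"]
  by (fastforce simp: cross_graph_def)

section \<open>Local isomorphisms as unique lifting of edges\<close>

lemma adj_neighborhood:
  "adj (neighborhood G v) a b \<longleftrightarrow> a = v \<and> adj G v b \<or> b = v \<and> adj G v a"
  by (auto simp: neighborhood_def adj_def doubleton_eq_iff)

lemma simple_graph_neighborhood:
  assumes "simple_graph G"
  shows "simple_graph (neighborhood G v)"
  using simple_graph_adjD[OF assms] unfolding simple_graph_def[of "neighborhood G v"]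
  by (fastforce simp: neighborhood_def)

text \<open>Neighborhoods are stars whose centers correspond under \<open>p\<close>, and the only
  edges join center and leaves. Since no vertex is its own neighbor, the center can be split off,
  and only the bijection on leaves is left.\<close>

lemma graph_iso_neighborhood_iff:
  assumes "simple_graph X" "simple_graph G"
  shows "graph_iso p (neighborhood X x) (neighborhood G (p x)) \<longleftrightarrow>
    bij_betw p {y. adj X x y} {w. adj G (p x) w}"
proof -
  have x: "x \<notin> {y. adj X x y}" and px: "p x \<notin> {w. adj G (p x) w}"
    using simple_graph_adjD(3)[OF assms(1)] simple_graph_adjD(3)[OF assms(2)] by auto
  have verts: "verts (neighborhood H v) = insert v {w. adj H v w}" for H :: "'z ugraph" and v
    by (simp add: neighborhood_def)
  have "bij_betw p (insert x {y. adj X x y}) (insert (p x) {w. adj G (p x) w}) \<longleftrightarrow>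
      bij_betw p {y. adj X x y} {w. adj G (p x) w}"
    using notIn_Un_bij_betw3[of x _ p, OF x px] by simp
  moreover have "adj (neighborhood X x) a b \<longleftrightarrow> adj (neighborhood G (p x)) (p a) (p b)"
    if bij: "bij_betw p {y. adj X x y} {w. adj G (p x) w}"
      and ab: "a \<in> insert x {y. adj X x y}" "b \<in> insert x {y. adj X x y}" for a b
  proof -
    \<comment> \<open>Leaves must not land on the center, or an edge from center to leaf could arise
      between two leaves.\<close>
    have "adj G (p x) (p c) \<and> p c \<noteq> p x" if "adj X x c" for c
      using bij_betw_apply[OF bij, of c] that px by auto
    then show ?thesis using ab x px by (auto simp: adj_neighborhood)
  qed
  ultimately show ?thesis
    using assms by (auto simp: graph_iso_def verts simple_graph_neighborhood)
qed

text \<open>Existence of lifts is surjectivity on leaves, uniqueness is injectivity. The right side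
  can use \<open>X\<close> itself: a neighbor of \<open>x\<close> over some \<open>w\<close>
  adjacent to \<open>p x\<close> lies in another fiber, because the base has no loops.\<close>

lemma graph_iso_neighborhood_cross_graph_iff:
  assumes "graph_morphism p X G"
  shows "graph_iso p (neighborhood (cross_graph X p) x) (neighborhood G (p x)) \<longleftrightarrow>
    (\<forall>w. adj G (p x) w \<longrightarrow> (\<exists>!y. adj X x y \<and> p y = w))"
proof -
  have simple: "simple_graph X" "simple_graph G"
    and mor: "\<And>a b. adj X a b \<Longrightarrow> adj G (p a) (p b) \<or> p a = p b"
    using assms by (auto simp: graph_morphism_def)
  have irrefl: "\<not> adj G v v" for v using simple_graph_adjD(3)[OF simple(2)] by blast
  have "graph_iso p (neighborhood (cross_graph X p) x) (neighborhood G (p x)) \<longleftrightarrow>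
      bij_betw p {y. adj X x y \<and> p x \<noteq> p y} {w. adj G (p x) w}"
    using graph_iso_neighborhood_iff[OF simple_graph_cross_graph[OF simple(1)] simple(2)]
    by simp
  also have "\<dots> \<longleftrightarrow> (\<forall>w. adj G (p x) w \<longrightarrow> (\<exists>!y. adj X x y \<and> p y = w))" (is "?L \<longleftrightarrow> ?R")
  proof
    assume L: ?L
    show ?R
    proof (intro allI impI)
      fix w assume w: "adj G (p x) w"
      then have "w \<in> p ` {y. adj X x y \<and> p x \<noteq> p y}" using L by (simp add: bij_betw_def)
      moreover have "p x \<noteq> w" using w irrefl by auto
      ultimately show "\<exists>!y. adj X x y \<and> p y = w"
        using bij_betw_imp_inj_on[OF L] by (auto simp: inj_on_def)
    qed
  next
    assume R: ?R
    have "inj_on p {y. adj X x y \<and> p x \<noteq> p y}"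
    proof (rule inj_onI)
      fix y z assume y: "y \<in> {y. adj X x y \<and> p x \<noteq> p y}" and z: "z \<in> {y. adj X x y \<and> p x \<noteq> p y}"
        and eq: "p y = p z"
      \<comment> \<open>Both \<open>y\<close> and \<open>z\<close> are ends of lifts at
        \<open>x\<close> of this one base edge.\<close>
      have "adj G (p x) (p y)" using y mor by blast
      then have "\<exists>!u. adj X x u \<and> p u = p y" using R by blast
      with y z eq show "y = z" by (simp add: Ex1_def) metis
    qed
    moreover have "p ` {y. adj X x y \<and> p x \<noteq> p y} = {w. adj G (p x) w}"
    proof (intro equalityI subsetI)
      fix w assume w: "w \<in> {w. adj G (p x) w}"
      then obtain y where "adj X x y" "p y = w" using R by auto
      then show "w \<in> p ` {y. adj X x y \<and> p x \<noteq> p y}" using w irrefl by auto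
    qed (use mor in auto)
    ultimately show ?L by (simp add: bij_betw_def)
  qed
  finally show ?thesis .
qed

section \<open>Graph bundles through lifting and matching of edges\<close>

text \<open>This removes the description operator: the end of a unique lift is the value of the
  transport, so the isomorphism condition can speak of pairs of edges over one base edge. No
  transport then has to be computed in a pullback or a product.\<close>

lemma fiber_bundle_iff:
  "fiber_bundle F (X, p, G) \<longleftrightarrow>
     simple_graph F \<and> finite (verts F) \<and> surj_graph_morphism p X G \<and>
     (\<forall>v\<in>verts G. \<exists>\<phi>. graph_iso \<phi> (fiber X p v) F) \<and>
     (\<forall>x\<in>verts X. \<forall>w. adj G (p x) w \<longrightarrow> (\<exists>!y. adj X x y \<and> p y = w)) \<and>
     (\<forall>x x' y y'. adj X x y \<longrightarrow> adj X x' y' \<longrightarrow> p x = p x' \<longrightarrow> p y = p y' \<longrightarrow>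
        p x \<noteq> p y \<longrightarrow> adj X x x' = adj X y y')"
  (is "_ \<longleftrightarrow> ?base \<and> ?fin \<and> ?surj \<and> ?fib \<and> ?lift \<and> ?match")
\<comment> \<open>These conjuncts occur on both sides; the remaining ones are compared only where
  they hold.\<close>
proof (cases "?base \<and> ?fin \<and> ?surj \<and> ?fib")
  case True
  then have mor: "graph_morphism p X G" and im: "p ` verts X = verts G"
    by (auto simp: surj_graph_morphism_def)
  then have simple: "simple_graph X" "simple_graph G"
    and adj: "\<And>a b. adj X a b \<Longrightarrow> adj G (p a) (p b) \<or> p a = p b"
    by (auto simp: graph_morphism_def)
  note X = simple_graph_adjD[OF simple(1)] and G = simple_graph_adjD[OF simple(2)]
  \<comment> \<open>The fold number comes from the isomorphisms of the fibers with \<open>F\<close>,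
    so the covering condition reduces to lifting.\<close>
  have "finite {x \<in> verts X. p x = v} \<and> card {x \<in> verts X. p x = v} = card (verts F)"
    if "v \<in> verts G" for v
  proof -
    from True that obtain \<phi> where "bij_betw \<phi> {x \<in> verts X. p x = v} (verts F)"
      by (auto simp: graph_iso_def)
    with True show ?thesis using bij_betw_finite bij_betw_same_card by blast
  qed
  moreover have "surj_graph_morphism p (cross_graph X p) G"
    using mor im simple_graph_cross_graph[OF simple(1)]
    by (auto simp: surj_graph_morphism_def graph_morphism_def)
  ultimately have cov: "covering (card (verts F)) (cross_graph X p) p G \<longleftrightarrow> ?lift"
    by (simp add: covering_def graph_iso_neighborhood_cross_graph_iff[OF mor])
  let ?t = "covering_transport (cross_graph X p) p"
  \<comment> \<open>Lifting is assumed here because the description defining the transport denotes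
    only when the lift is unique.\<close>
  have iff: "(\<forall>v w. adj G v w \<longrightarrow> graph_iso (?t w) (fiber X p v) (fiber X p w)) \<longleftrightarrow> ?match"
    if lift: ?lift
  proof -
    have ex: "\<exists>!y. adj X x y \<and> p y = w" if "x \<in> verts X" "adj G (p x) w" for x w
      using lift that by blast
    have t_eq: "?t w x = (THE y. adj X x y \<and> p y = w)" if "adj G (p x) w" for w x
      unfolding covering_transport_def
      by (rule arg_cong[where f = The], rule ext) (use X(2) G(3)[OF that] in auto)
    have t: "adj X x (?t w x) \<and> p (?t w x) = w \<and> ?t w x \<in> verts X"
      if "x \<in> verts X" "adj G (p x) w" for w x
      using theI'[OF ex[OF that]] X(2) unfolding t_eq[OF that(2)] by blast
    have t_unique: "?t w x = y" if "adj X x y" "p y = w" "adj G (p x) w" for w x y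
      using ex[of x w] t[of x w] X[OF that(1)] that by blast
    \<comment> \<open>An edge read backwards lifts the reversed base edge, so the transports along
      \<open>v\<close>, \<open>w\<close> and along \<open>w\<close>, \<open>v\<close> are mutually
      inverse.\<close>
    have t_inv: "?t v (?t w x) = x" if "x \<in> verts X" "p x = v" "adj G v w" for v w x
      using t[of x w] that by (intro t_unique) (auto simp: adj_commute)
    have bij: "bij_betw (?t w) (verts (fiber X p v)) (verts (fiber X p w))"
      if vw: "adj G v w" for v w
    proof -
      have wv: "adj G w v" using vw by (simp add: adj_commute)
      show ?thesis
        using t_inv[OF _ _ vw] t_inv[OF _ _ wv] t[of _ w] t[of _ v] vw wv X(2)
        by (intro bij_betw_byWitness[where f' = "?t v"]) auto
    qed
    have iso: "graph_iso (?t w) (fiber X p v) (fiber X p w) \<longleftrightarrow>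
        (\<forall>x x'. x \<in> verts X \<longrightarrow> x' \<in> verts X \<longrightarrow> p x = v \<longrightarrow> p x' = v \<longrightarrow>
           adj X x x' = adj X (?t w x) (?t w x'))"
      if vw: "adj G v w" for v w
    proof -
      have "?t w x \<in> verts X \<and> p (?t w x) = w" if "x \<in> verts X" "p x = v" for x
        using t[of x w] that vw by blast
      then show ?thesis
        using bij[OF vw] simple_graph_fiber[OF simple(1)] by (auto simp: graph_iso_def)
    qed
    show ?thesis
    proof
      assume L: "\<forall>v w. adj G v w \<longrightarrow> graph_iso (?t w) (fiber X p v) (fiber X p w)"
      show ?match
      proof (intro allI impI)
        fix x x' y y'
        assume *: "adj X x y" "adj X x' y'" "p x = p x'" "p y = p y'" "p x \<noteq> p y"
        then have vw: "adj G (p x) (p y)" using adj by blast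
        \<comment> \<open>The given edges are lifts, so their ends are the transports of
          \<open>x\<close> and \<open>x'\<close>.\<close>
        have "?t (p y) x = y" "?t (p y) x' = y'" using * vw by (auto intro!: t_unique)
        moreover have "\<forall>z z'. z \<in> verts X \<longrightarrow> z' \<in> verts X \<longrightarrow> p z = p x \<longrightarrow> p z' = p x \<longrightarrow>
            adj X z z' = adj X (?t (p y) z) (?t (p y) z')"
          using L vw unfolding iso[OF vw, symmetric] by blast
        ultimately show "adj X x x' = adj X y y'"
          using X(1)[OF *(1)] X(1)[OF *(2)] *(3) by simp
      qed
    next
      assume R: ?match
      show "\<forall>v w. adj G v w \<longrightarrow> graph_iso (?t w) (fiber X p v) (fiber X p w)"
      proof (intro allI impI)
        fix v w assume vw: "adj G v w"
        have "v \<noteq> w" using G(3)[OF vw] .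
        show "graph_iso (?t w) (fiber X p v) (fiber X p w)"
          unfolding iso[OF vw]
        proof (intro allI impI)
          fix x x' assume "x \<in> verts X" "x' \<in> verts X" "p x = v" "p x' = v"
          \<comment> \<open>Matching is applied to the edges from \<open>x\<close> and
            \<open>x'\<close> to their transports.\<close>
          with t[of x w] t[of x' w] vw \<open>v \<noteq> w\<close>
          show "adj X x x' = adj X (?t w x) (?t w x')"
            by (intro R[rule_format]) auto
        qed
      qed
    qed
  qed
  show ?thesis
  proof (cases ?lift)
    case True
    show ?thesis unfolding fiber_bundle.simps cov iff[OF True] by (rule refl)
  next
    case False
    then show ?thesis unfolding fiber_bundle.simps cov by (simp only: simp_thms)
  qed
next
  case False
  then show ?thesis
    by (simp only: fiber_bundle.simps conj_assoc[symmetric] simp_thms)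
qed

lemma fiber_bundleD:
  assumes "fiber_bundle F (X, p, G)"
  shows "simple_graph F" "finite (verts F)" "simple_graph X" "simple_graph G"
    "p ` verts X = verts G"
    "\<And>x y. adj X x y \<Longrightarrow> adj G (p x) (p y) \<or> p x = p y"
    "\<And>v. v \<in> verts G \<Longrightarrow> \<exists>\<phi>. graph_iso \<phi> (fiber X p v) F"
    "\<And>x w. x \<in> verts X \<Longrightarrow> adj G (p x) w \<Longrightarrow> \<exists>!y. adj X x y \<and> p y = w"
    "\<And>x x' y y'. adj X x y \<Longrightarrow> adj X x' y' \<Longrightarrow> p x = p x' \<Longrightarrow> p y = p y' \<Longrightarrow>
        p x \<noteq> p y \<Longrightarrow> adj X x x' = adj X y y'"
  using assms unfolding fiber_bundle_iff surj_graph_morphism_def graph_morphism_def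
  by blast+

text \<open>Since \<open>p x\<close> and \<open>p y\<close> differ, they are adjacent in the base,
  and \<open>y\<close> and \<open>y'\<close> both end lifts of that edge at \<open>x\<close>. It
  serves to show that edges over one base edge with a common end coincide.\<close>

lemma fiber_bundle_lift_unique:
  assumes "fiber_bundle F (X, p, G)" "adj X x y" "adj X x y'" "p y = p y'" "p x \<noteq> p y"
  shows "y = y'"
proof -
  note B = fiber_bundleD[OF assms(1)]
  have "x \<in> verts X" "adj G (p x) (p y)"
    using simple_graph_adjD(1)[OF B(3) assms(2)] B(6)[OF assms(2)] assms(5) by auto
  then have "\<exists>!z. adj X x z \<and> p z = p y" by (rule B(8))
  then show ?thesis using assms(2-4) by auto
qed

section \<open>Pullbacks of graph bundles\<close>

lemma verts_pullback: "verts (fst (pullback G' f (X, p, G))) = pullback_verts G' f X p"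
  by simp

lemma mem_pullback_verts [simp]:
  "(v, x) \<in> pullback_verts G' f X p \<longleftrightarrow> v \<in> verts G' \<and> x \<in> verts X \<and> f v = p x"
  by (simp add: pullback_verts_def)

lemma simple_graph_pullback:
  assumes "simple_graph G'" "simple_graph X"
  shows "simple_graph (fst (pullback G' f (X, p, G)))"
  using simple_graph_adjD(3)[OF assms(1)] simple_graph_adjD(3)[OF assms(2)]
  unfolding simple_graph_def by fastforce

text \<open>Exposes the triple while its total space stays folded, to be used only through its
  vertices and adjacency.\<close>

lemma pullback_eq: "pullback G' f (X, p, G) = (fst (pullback G' f (X, p, G)), fst, G')"
  by simp

text \<open>The fiber over \<open>v\<close> is a copy of the fiber over \<open>f v\<close>. An edge
  contracted by \<open>f\<close> lifts with constant second coordinate, any other edge lifts as its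
  image does in \<open>X\<close>.\<close>

lemma fiber_bundle_pullback:
  assumes "fiber_bundle F (X, p, G)" "graph_morphism f G' G"
  shows "fiber_bundle F (pullback G' f (X, p, G))"
proof -
  note B = fiber_bundleD[OF assms(1)]
  have G': "simple_graph G'" and f_verts: "\<And>v. v \<in> verts G' \<Longrightarrow> f v \<in> verts G"
    and f_adj: "\<And>v w. adj G' v w \<Longrightarrow> adj G (f v) (f w) \<or> f v = f w"
    using assms(2) by (auto simp: graph_morphism_def)
  note X = simple_graph_adjD[OF B(3)] and G = simple_graph_adjD[OF B(4)]
    and A' = simple_graph_adjD[OF G']
  define P where "P = fst (pullback G' f (X, p, G))"
  have vP: "verts P = pullback_verts G' f X p" unfolding P_def by (rule verts_pullback)
  have aP: "adj P (v, x) (w, y) \<longleftrightarrow>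
      (v, x) \<in> pullback_verts G' f X p \<and> (w, y) \<in> pullback_verts G' f X p \<and>
      (v = w \<and> adj X x y \<or> adj G' v w \<and> f v = f w \<and> x = y \<or>
       adj G' v w \<and> adj G (f v) (f w) \<and> adj X x y)" for v x w y
    unfolding P_def by (rule adj_pullback)
  have P: "simple_graph P" unfolding P_def by (rule simple_graph_pullback[OF G' B(3)])
  have "surj_graph_morphism fst P G'"
  proof -
    have "fst ` verts P = verts G'"
    proof (intro equalityI subsetI)
      fix v assume v: "v \<in> verts G'"
      then have "f v \<in> p ` verts X" using f_verts B(5) by simp
      then obtain x where "x \<in> verts X" "f v = p x" by auto
      then have "(v, x) \<in> verts P" using v by (simp add: vP)
      then show "v \<in> fst ` verts P" by force
    qed (auto simp: vP)
    then show ?thesis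
      using P G' by (auto simp: surj_graph_morphism_def graph_morphism_def aP)
  qed
  moreover have "\<exists>\<phi>. graph_iso \<phi> (fiber P fst v) F" if v: "v \<in> verts G'" for v
  proof -
    have "bij_betw snd {a \<in> verts P. fst a = v} {x \<in> verts X. p x = f v}"
      by (rule bij_betw_byWitness[where f' = "Pair v"]) (use v in \<open>auto simp: vP\<close>)
    \<comment> \<open>Inside a fiber only condition (I) applies, since (II) and (III) would need a
      loop in \<open>G'\<close>.\<close>
    then have "graph_iso snd (fiber P fst v) (fiber X p (f v))"
      using P B(3) simple_graph_adjD(3)[OF G'] by (auto simp: graph_iso_def simple_graph_fiber vP aP)
    moreover obtain \<phi> where "graph_iso \<phi> (fiber X p (f v)) F"
      using B(7)[OF f_verts[OF v]] by blast
    ultimately show ?thesis using graph_iso_trans by blast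
  qed
  moreover have "\<exists>!b. adj P a b \<and> fst b = w" if a: "a \<in> verts P" and vw: "adj G' (fst a) w" for a w
  proof -
    obtain v x where ax: "a = (v, x)" by (cases a)
    then have vx: "v \<in> verts G'" "x \<in> verts X" "f v = p x" "adj G' v w" "v \<noteq> w" "w \<in> verts G'"
      using a vw A'(2,3)[OF vw] by (auto simp: vP)
    show ?thesis
    proof (cases "f v = f w")
      case True
      \<comment> \<open>This excludes (III), and \<open>v \<noteq> w\<close> excludes (I); (II)
        forces the lift to end in \<open>(w, x)\<close>.\<close>
      then have "\<not> adj G (f v) (f w)" using G(3) by auto
      then have "adj P a b \<and> fst b = w \<longleftrightarrow> b = (w, x)" for b
        using vx True by (cases b) (auto simp: ax aP)
      then show ?thesis by simp
    next
      case False
      then have fvw: "adj G (p x) (f w)" using f_adj vx by metis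
      \<comment> \<open>Only (III) remains, so the lifts of the edge at \<open>a\<close> are those
        of its image at \<open>x\<close>.\<close>
      have "adj P a b \<and> fst b = w \<longleftrightarrow> fst b = w \<and> adj X x (snd b) \<and> p (snd b) = f w" for b
        using vx False fvw X(2) by (cases b) (auto simp: ax aP)
      moreover obtain y where "\<And>z. adj X x z \<and> p z = f w \<longleftrightarrow> z = y"
        using B(8)[OF vx(2) fvw] by metis
      ultimately have "adj P a b \<and> fst b = w \<longleftrightarrow> b = (w, y)" for b
        by (simp add: prod_eq_iff)
      then show ?thesis by simp
    qed
  qed
  moreover have "adj P a a' = adj P b b'"
    if ab: "adj P a b" "adj P a' b'" "fst a = fst a'" "fst b = fst b'" "fst a \<noteq> fst b" for a a' b b'
  proof -
    obtain v x x' w y y' where *: "a = (v, x)" "a' = (v, x')" "b = (w, y)" "b' = (w, y')"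
      using ab(3,4) by (metis prod.collapse)
    have irrefl: "\<not> adj G u u" "\<not> adj G' u' u'" for u u' using G(3) A'(3) by blast+
    have mem: "a \<in> verts P" "a' \<in> verts P" "b \<in> verts P" "b' \<in> verts P"
      using simple_graph_adjD(1,2)[OF P] ab(1,2) by blast+
    then have p: "p x = f v" "p x' = f v" "p y = f w" "p y' = f w" by (auto simp: * vP)
    have "v \<noteq> w" using ab(5) by (simp add: *)
    then have e: "f v = f w \<and> x = y \<or> adj G (f v) (f w) \<and> adj X x y"
        "f v = f w \<and> x' = y' \<or> adj G (f v) (f w) \<and> adj X x' y'"
      using ab(1,2) unfolding * aP by blast+
    have "adj X x x' = adj X y y'"
    proof (cases "f v = f w")
      case True
      \<comment> \<open>Over a contracted edge \<open>x = y\<close> and \<open>x' = y'\<close>,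
        which makes the claim trivial.\<close>
      then show ?thesis using e irrefl(1) by simp
    next
      case False
      then have "adj X x y" "adj X x' y'" using e by blast+
      then show ?thesis by (rule B(9)) (use p False in simp_all)
    qed
    moreover have "adj P a a' = adj X x x'" "adj P b b' = adj X y y'"
      using mem irrefl(2) unfolding * aP vP by blast+
    ultimately show ?thesis by simp
  qed
  ultimately have "fiber_bundle F (P, fst, G')"
    unfolding fiber_bundle_iff using B(1,2) by blast
  then show ?thesis using pullback_eq P_def by metis
qed

section \<open>Subdirect products of graph bundles\<close>

text \<open>This is the fiber of a subdirect product: (III) needs adjacent base vertices, so within
  a fiber just (I) and (II) survive, each moving one coordinate.\<close>

definition cartesian_product_graph :: "'a ugraph \<Rightarrow> 'b ugraph \<Rightarrow> ('a \<times> 'b) ugraph" where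
  "cartesian_product_graph G H =
     \<lparr>verts = verts G \<times> verts H,
      edges = {{(a, b), (a', b')} | a b a' b'.
        a = a' \<and> a \<in> verts G \<and> adj H b b' \<or> adj G a a' \<and> b = b' \<and> b \<in> verts H}\<rparr>"

lemma verts_cartesian_product_graph [simp]:
  "verts (cartesian_product_graph G H) = verts G \<times> verts H"
  by (simp add: cartesian_product_graph_def)

lemma adj_cartesian_product_graph [simp]:
  "adj (cartesian_product_graph G H) (a, b) (a', b') \<longleftrightarrow>
     a = a' \<and> a \<in> verts G \<and> adj H b b' \<or> adj G a a' \<and> b = b' \<and> b \<in> verts H"
  by (auto simp: cartesian_product_graph_def adj_def doubleton_eq_iff insert_commute)

lemma simple_graph_cartesian_product_graph:
  assumes "simple_graph G" "simple_graph H"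
  shows "simple_graph (cartesian_product_graph G H)"
  using simple_graph_adjD[OF assms(1)] simple_graph_adjD[OF assms(2)]
  unfolding simple_graph_def[of "cartesian_product_graph G H"]
  by (fastforce simp: cartesian_product_graph_def)

text \<open>An edge between different fibers is a pair of edges, one in each factor, over the same
  base edge. Lifting and matching can therefore be checked coordinatewise.\<close>

lemma fiber_bundle_subdirect_product:
  fixes X\<^sub>1 :: "'x ugraph" and X\<^sub>2 :: "'y ugraph" and G :: "'b ugraph"
  assumes "fiber_bundle F\<^sub>1 (X\<^sub>1, p\<^sub>1, G)" "fiber_bundle F\<^sub>2 (X\<^sub>2, p\<^sub>2, G)"
  shows "fiber_bundle (cartesian_product_graph F\<^sub>1 F\<^sub>2)
    (subdirect_product (X\<^sub>1, p\<^sub>1, G) (X\<^sub>2, p\<^sub>2, G))"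
proof -
  note B1 = fiber_bundleD[OF assms(1)] and B2 = fiber_bundleD[OF assms(2)]
  note X1 = simple_graph_adjD[OF B1(3)] and X2 = simple_graph_adjD[OF B2(3)]
    and G = simple_graph_adjD[OF B1(4)]
  have irrefl: "\<not> adj G u u" "\<not> adj X\<^sub>1 x x" "\<not> adj X\<^sub>2 y y" for u x y
    using G(3) X1(3) X2(3) by blast+
  define P where "P = fst (pullback X\<^sub>1 p\<^sub>1 (X\<^sub>2, p\<^sub>2, G))"
  define q :: "'x \<times> 'y \<Rightarrow> 'b" where "q = (\<lambda>(x, y). p\<^sub>1 x)"
  have q [simp]: "q (x, y) = p\<^sub>1 x" for x y by (simp add: q_def)
  have vP: "verts P = pullback_verts X\<^sub>1 p\<^sub>1 X\<^sub>2 p\<^sub>2" unfolding P_def by (rule verts_pullback)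
  have aP: "adj P (x, y) (x', y') \<longleftrightarrow>
      (x, y) \<in> pullback_verts X\<^sub>1 p\<^sub>1 X\<^sub>2 p\<^sub>2 \<and> (x', y') \<in> pullback_verts X\<^sub>1 p\<^sub>1 X\<^sub>2 p\<^sub>2 \<and>
      (x = x' \<and> adj X\<^sub>2 y y' \<or> adj X\<^sub>1 x x' \<and> p\<^sub>1 x = p\<^sub>1 x' \<and> y = y' \<or>
       adj X\<^sub>1 x x' \<and> adj G (p\<^sub>1 x) (p\<^sub>1 x') \<and> adj X\<^sub>2 y y')" for x y x' y'
    unfolding P_def by (rule adj_pullback)
  have P: "simple_graph P" unfolding P_def by (rule simple_graph_pullback[OF B1(3) B2(3)])
  have "surj_graph_morphism q P G"
  proof -
    have "q ` verts P = verts G"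
    proof (intro equalityI subsetI)
      fix v assume "v \<in> verts G"
      then have "v \<in> p\<^sub>1 ` verts X\<^sub>1" "v \<in> p\<^sub>2 ` verts X\<^sub>2" using B1(5) B2(5) by auto
      then obtain x y where "(x, y) \<in> verts P" "q (x, y) = v" by (auto simp: vP)
      then show "v \<in> q ` verts P" by blast
    next
      fix v assume "v \<in> q ` verts P"
      then obtain x where "x \<in> verts X\<^sub>1" "v = p\<^sub>1 x" by (auto simp: vP)
      then show "v \<in> verts G" using B1(5) by blast
    qed
    then show ?thesis
      using P B1(4) by (auto simp: surj_graph_morphism_def graph_morphism_def aP)
  qed
  moreover have "\<exists>\<phi>. graph_iso \<phi> (fiber P q v) (cartesian_product_graph F\<^sub>1 F\<^sub>2)"
    if v: "v \<in> verts G" for v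
  proof -
    obtain \<phi> \<psi> where iso: "graph_iso \<phi> (fiber X\<^sub>1 p\<^sub>1 v) F\<^sub>1" "graph_iso \<psi> (fiber X\<^sub>2 p\<^sub>2 v) F\<^sub>2"
      using B1(7)[OF v] B2(7)[OF v] by blast
    let ?V = "{x \<in> verts X\<^sub>1. p\<^sub>1 x = v}" and ?W = "{y \<in> verts X\<^sub>2. p\<^sub>2 y = v}"
    have bij: "bij_betw \<phi> ?V (verts F\<^sub>1)" "bij_betw \<psi> ?W (verts F\<^sub>2)"
      and adj: "\<And>x x'. x \<in> ?V \<Longrightarrow> x' \<in> ?V \<Longrightarrow> adj F\<^sub>1 (\<phi> x) (\<phi> x') = adj X\<^sub>1 x x'"
        "\<And>y y'. y \<in> ?W \<Longrightarrow> y' \<in> ?W \<Longrightarrow> adj F\<^sub>2 (\<psi> y) (\<psi> y') = adj X\<^sub>2 y y'"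
      using iso by (auto simp: graph_iso_def)
    \<comment> \<open>The Cartesian product also tests equality of coordinates, so injectivity is
      needed besides preservation of edges.\<close>
    have inj: "\<And>x x'. x \<in> ?V \<Longrightarrow> x' \<in> ?V \<Longrightarrow> \<phi> x = \<phi> x' \<longleftrightarrow> x = x'"
        "\<And>y y'. y \<in> ?W \<Longrightarrow> y' \<in> ?W \<Longrightarrow> \<psi> y = \<psi> y' \<longleftrightarrow> y = y'"
      using bij by (meson bij_betw_imp_inj_on inj_on_eq_iff)+
    have V: "verts (fiber P q v) = ?V \<times> ?W" by (auto simp: vP)
    have "bij_betw (map_prod \<phi> \<psi>) (?V \<times> ?W) (verts F\<^sub>1 \<times> verts F\<^sub>2)"
      using bij by (rule bij_betw_map_prod)
    moreover have "adj (fiber P q v) (x, y) (x', y') \<longleftrightarrow>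
        adj (cartesian_product_graph F\<^sub>1 F\<^sub>2) (\<phi> x, \<psi> y) (\<phi> x', \<psi> y')"
      if "x \<in> ?V" "y \<in> ?W" "x' \<in> ?V" "y' \<in> ?W" for x y x' y'
      using that adj(1)[OF that(1,3)] adj(2)[OF that(2,4)] inj(1)[OF that(1,3)] inj(2)[OF that(2,4)]
        bij_betw_apply[OF bij(1) that(1)] bij_betw_apply[OF bij(2) that(2)] irrefl
      by (auto simp: aP vP)
    ultimately have "graph_iso (map_prod \<phi> \<psi>) (fiber P q v) (cartesian_product_graph F\<^sub>1 F\<^sub>2)"
      using simple_graph_fiber[OF P] simple_graph_cartesian_product_graph[OF B1(1) B2(1)]
      unfolding graph_iso_def V by (simp del: adj_fiber adj_cartesian_product_graph)
    then show ?thesis by blast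
  qed
  moreover have "\<exists>!b. adj P a b \<and> q b = w" if a: "a \<in> verts P" and vw: "adj G (q a) w" for a w
  proof -
    obtain x y where axy: "a = (x, y)" by (cases a)
    have xy: "x \<in> verts X\<^sub>1" "y \<in> verts X\<^sub>2" "p\<^sub>1 x = p\<^sub>2 y" "adj G (p\<^sub>1 x) w" "adj G (p\<^sub>2 y) w"
      using a vw by (auto simp: axy vP)
    obtain x' where x': "\<And>z. adj X\<^sub>1 x z \<and> p\<^sub>1 z = w \<longleftrightarrow> z = x'"
      using B1(8)[OF xy(1,4)] by metis
    obtain y' where y': "\<And>z. adj X\<^sub>2 y z \<and> p\<^sub>2 z = w \<longleftrightarrow> z = y'"
      using B2(8)[OF xy(2,5)] by metis
    have "adj P a b \<and> q b = w \<longleftrightarrow> (adj X\<^sub>1 x (fst b) \<and> p\<^sub>1 (fst b) = w) \<and>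
        (adj X\<^sub>2 y (snd b) \<and> p\<^sub>2 (snd b) = w)" for b
    proof (cases b)
      case (Pair s t)
      \<comment> \<open>This rules out (I) and (II), which stay within a fiber; (III) splits into
        one lift per factor.\<close>
      have "p\<^sub>1 x \<noteq> w" using xy(4) irrefl(1) by blast
      then have "adj P (x, y) (s, t) \<and> p\<^sub>1 s = w \<longleftrightarrow>
          s \<in> verts X\<^sub>1 \<and> t \<in> verts X\<^sub>2 \<and> p\<^sub>1 s = p\<^sub>2 t \<and> adj X\<^sub>1 x s \<and> p\<^sub>1 s = w \<and> adj X\<^sub>2 y t"
        using xy unfolding aP mem_pullback_verts by blast
      then show ?thesis using X1(2)[of x s] X2(2)[of y t] unfolding Pair axy q by auto
    qed
    then have "adj P a b \<and> q b = w \<longleftrightarrow> b = (x', y')" for b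
      unfolding x' y' by (simp add: prod_eq_iff)
    then show ?thesis by simp
  qed
  moreover have "adj P a a' = adj P b b'"
    if "adj P a b" "adj P a' b'" "q a = q a'" "q b = q b'" "q a \<noteq> q b" for a a' b b'
  proof -
    obtain x y x' y' s t s' t'
      where *: "a = (x, y)" "a' = (x', y')" "b = (s, t)" "b' = (s', t')"
      by (metis prod.collapse)
    have V: "a \<in> verts P" "a' \<in> verts P" "b \<in> verts P" "b' \<in> verts P"
      using simple_graph_adjD(1,2)[OF P] that(1,2) by blast+
    then have p: "p\<^sub>1 x = p\<^sub>2 y" "p\<^sub>1 x' = p\<^sub>2 y'" "p\<^sub>1 s = p\<^sub>2 t" "p\<^sub>1 s' = p\<^sub>2 t'"
      by (auto simp: * vP)
    have eq: "p\<^sub>1 x = p\<^sub>1 x'" "p\<^sub>1 s = p\<^sub>1 s'" "p\<^sub>1 x \<noteq> p\<^sub>1 s" using that(3-5) by (auto simp: *)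
    have e: "adj X\<^sub>1 x s" "adj X\<^sub>1 x' s'" "adj X\<^sub>2 y t" "adj X\<^sub>2 y' t'"
      "adj G (p\<^sub>1 x) (p\<^sub>1 s)"
      using that(1,2) eq p unfolding * aP by auto
    have m: "adj X\<^sub>1 x x' = adj X\<^sub>1 s s'" "adj X\<^sub>2 y y' = adj X\<^sub>2 t t'"
      using B1(9)[OF e(1,2)] B2(9)[OF e(3,4)] eq p by auto
    \<comment> \<open>The reversed edges give the converse directions below: equal far ends force
      equal near ends, by unique lifting from the far end.\<close>
    note e' = e(1-4)[THEN adj_commute[THEN iffD1]]
    have "x = x' \<longleftrightarrow> s = s'"
      using fiber_bundle_lift_unique[OF assms(1)] e(1,2) e'(1,2) eq by metis
    moreover have "y = y' \<longleftrightarrow> t = t'"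
      using fiber_bundle_lift_unique[OF assms(2)] e(3,4) e'(3,4) eq p by metis
    moreover have "adj P a a' \<longleftrightarrow> x = x' \<and> adj X\<^sub>2 y y' \<or> adj X\<^sub>1 x x' \<and> y = y'"
        "adj P b b' \<longleftrightarrow> s = s' \<and> adj X\<^sub>2 t t' \<or> adj X\<^sub>1 s s' \<and> t = t'"
      using V irrefl(1) eq unfolding * aP vP by auto
    ultimately show ?thesis using m by simp
  qed
  moreover have "finite (verts (cartesian_product_graph F\<^sub>1 F\<^sub>2))"
    using B1(2) B2(2) by simp
  ultimately have "fiber_bundle (cartesian_product_graph F\<^sub>1 F\<^sub>2) (P, q, G)"
    unfolding fiber_bundle_iff using simple_graph_cartesian_product_graph[OF B1(1) B2(1)] by blast
  then show ?thesis by (simp only: subdirect_product.simps P_def q_def)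
qed

section \<open>The equivalence of the two bundles\<close>

theorem theorem4p5:
  fixes F\<^sub>1 :: "'f1 ugraph" and F\<^sub>2 :: "'f2 ugraph"
    and X\<^sub>1 :: "'x1 ugraph" and X\<^sub>2 :: "'x2 ugraph"
    and \<Gamma> :: "'b ugraph" and \<Gamma>' :: "'c ugraph"
    and p\<^sub>1 :: "'x1 \<Rightarrow> 'b" and p\<^sub>2 :: "'x2 \<Rightarrow> 'b" and f :: "'c \<Rightarrow> 'b"
  assumes "fiber_bundle F\<^sub>1 (X\<^sub>1, p\<^sub>1, \<Gamma>)"
    and "fiber_bundle F\<^sub>2 (X\<^sub>2, p\<^sub>2, \<Gamma>)"
    and "graph_morphism f \<Gamma>' \<Gamma>"
  shows "bundle_equivalent
    (pullback \<Gamma>' f (subdirect_product (X\<^sub>1, p\<^sub>1, \<Gamma>) (X\<^sub>2, p\<^sub>2, \<Gamma>)))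
    (subdirect_product (pullback \<Gamma>' f (X\<^sub>1, p\<^sub>1, \<Gamma>)) (pullback \<Gamma>' f (X\<^sub>2, p\<^sub>2, \<Gamma>)))"
proof -
  define P where "P = fst (pullback X\<^sub>1 p\<^sub>1 (X\<^sub>2, p\<^sub>2, \<Gamma>))"
  define q :: "'x1 \<times> 'x2 \<Rightarrow> 'b" where "q = (\<lambda>(x, y). p\<^sub>1 x)"
  define Y1 where "Y1 = fst (pullback \<Gamma>' f (X\<^sub>1, p\<^sub>1, \<Gamma>))"
  define Y2 where "Y2 = fst (pullback \<Gamma>' f (X\<^sub>2, p\<^sub>2, \<Gamma>))"
  define L where "L = fst (pullback \<Gamma>' f (P, q, \<Gamma>))"
  define R where "R = fst (pullback Y1 fst (Y2, fst :: _ \<Rightarrow> 'c, \<Gamma>'))"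
  define r :: "('c \<times> 'x1) \<times> ('c \<times> 'x2) \<Rightarrow> 'c" where "r = (\<lambda>(a, b). fst a)"
  have sub: "subdirect_product (X\<^sub>1, p\<^sub>1, \<Gamma>) (X\<^sub>2, p\<^sub>2, \<Gamma>) = (P, q, \<Gamma>)"
    by (simp only: subdirect_product.simps P_def q_def)
  have lhs: "pullback \<Gamma>' f (P, q, \<Gamma>) = (L, fst, \<Gamma>')"
    unfolding L_def by (rule pullback_eq)
  have Y1: "pullback \<Gamma>' f (X\<^sub>1, p\<^sub>1, \<Gamma>) = (Y1, fst, \<Gamma>')"
    and Y2: "pullback \<Gamma>' f (X\<^sub>2, p\<^sub>2, \<Gamma>) = (Y2, fst, \<Gamma>')"
    unfolding Y1_def Y2_def by (rule pullback_eq)+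
  have rhs: "subdirect_product (Y1, fst, \<Gamma>') (Y2, fst, \<Gamma>') = (R, r, \<Gamma>')"
    by (simp only: subdirect_product.simps R_def r_def)
  \<comment> \<open>Equivalence demands that both sides be graph bundles; the same facts also supply
    simplicity of the graphs involved.\<close>
  have bP: "fiber_bundle (cartesian_product_graph F\<^sub>1 F\<^sub>2) (P, q, \<Gamma>)"
    using fiber_bundle_subdirect_product[OF assms(1,2)] unfolding sub .
  have bL: "fiber_bundle (cartesian_product_graph F\<^sub>1 F\<^sub>2) (L, fst, \<Gamma>')"
    using fiber_bundle_pullback[OF bP assms(3)] unfolding lhs .
  have bR: "fiber_bundle (cartesian_product_graph F\<^sub>1 F\<^sub>2) (R, r, \<Gamma>')"
    using fiber_bundle_subdirect_product[OF
        fiber_bundle_pullback[OF assms(1,3), unfolded Y1]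
        fiber_bundle_pullback[OF assms(2,3), unfolded Y2]] unfolding rhs .
  define \<Phi> :: "'c \<times> 'x1 \<times> 'x2 \<Rightarrow> ('c \<times> 'x1) \<times> ('c \<times> 'x2)"
    where "\<Phi> = (\<lambda>(v, x, y). ((v, x), (v, y)))"
  have q [simp]: "q (x, y) = p\<^sub>1 x" for x y by (simp add: q_def)
  have vP: "verts P = pullback_verts X\<^sub>1 p\<^sub>1 X\<^sub>2 p\<^sub>2" unfolding P_def by (rule verts_pullback)
  have vL: "verts L = pullback_verts \<Gamma>' f P q" unfolding L_def by (rule verts_pullback)
  have vY1: "verts Y1 = pullback_verts \<Gamma>' f X\<^sub>1 p\<^sub>1" unfolding Y1_def by (rule verts_pullback)
  have vY2: "verts Y2 = pullback_verts \<Gamma>' f X\<^sub>2 p\<^sub>2" unfolding Y2_def by (rule verts_pullback)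
  have vR: "verts R = pullback_verts Y1 fst Y2 fst" unfolding R_def by (rule verts_pullback)
  note aP = adj_pullback[of X\<^sub>1 p\<^sub>1 X\<^sub>2 p\<^sub>2 \<Gamma>, folded P_def]
    and aL = adj_pullback[of \<Gamma>' f P q \<Gamma>, folded L_def]
    and aY1 = adj_pullback[of \<Gamma>' f X\<^sub>1 p\<^sub>1 \<Gamma>, folded Y1_def]
    and aY2 = adj_pullback[of \<Gamma>' f X\<^sub>2 p\<^sub>2 \<Gamma>, folded Y2_def]
    and aR = adj_pullback[of Y1 fst Y2 fst \<Gamma>', folded R_def]
  have irrefl: "\<not> adj \<Gamma> u u" "\<not> adj \<Gamma>' u' u'" "\<not> adj X\<^sub>1 x x" "\<not> adj X\<^sub>2 y y" for u u' x y
    using simple_graph_adjD(3)[OF fiber_bundleD(4)[OF bP]]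
      simple_graph_adjD(3)[OF fiber_bundleD(4)[OF bL]]
      simple_graph_adjD(3)[OF fiber_bundleD(3)[OF assms(1)]]
      simple_graph_adjD(3)[OF fiber_bundleD(3)[OF assms(2)]] by blast+
  have mem: "(v, x, y) \<in> verts L \<longleftrightarrow>
      v \<in> verts \<Gamma>' \<and> x \<in> verts X\<^sub>1 \<and> y \<in> verts X\<^sub>2 \<and> p\<^sub>1 x = f v \<and> p\<^sub>2 y = f v" for v x y
    by (auto simp: vL vP)
  have "bij_betw \<Phi> (verts L) (verts R)"
    \<comment> \<open>The inverse drops the second base coordinate, which equals the first on
      vertices of \<open>R\<close>.\<close>
    by (rule bij_betw_byWitness[where f' = "\<lambda>((v, x), (w, y)). (v, x, y)"])
      (auto simp: \<Phi>_def vL vP vR vY1 vY2)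
  moreover have "adj L (v, x, y) (v', x', y') \<longleftrightarrow> adj R ((v, x), (v, y)) ((v', x'), (v', y'))"
    if "(v, x, y) \<in> verts L" "(v', x', y') \<in> verts L" for v x y v' x' y'
  proof -
    have m: "v \<in> verts \<Gamma>'" "x \<in> verts X\<^sub>1" "y \<in> verts X\<^sub>2" "p\<^sub>1 x = f v" "p\<^sub>2 y = f v"
      "v' \<in> verts \<Gamma>'" "x' \<in> verts X\<^sub>1" "y' \<in> verts X\<^sub>2" "p\<^sub>1 x' = f v'" "p\<^sub>2 y' = f v'"
      using that unfolding mem by auto
    have "adj P (x, y) (x', y') \<longleftrightarrow> x = x' \<and> adj X\<^sub>2 y y' \<or>
        adj X\<^sub>1 x x' \<and> f v = f v' \<and> y = y' \<or> adj X\<^sub>1 x x' \<and> adj \<Gamma> (f v) (f v') \<and> adj X\<^sub>2 y y'"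
      unfolding aP by (simp add: m)
    \<comment> \<open>Both sides are compared with these four alternatives. With
      \<open>v = v'\<close>, (III) in \<open>P\<close> would be a loop at \<open>f v\<close>; with
      \<open>f v\<close> and \<open>f v'\<close> adjacent, (I) and (II) in \<open>P\<close> are
      impossible, since they need \<open>f v = f v'\<close>.\<close>
    then have "adj L (v, x, y) (v', x', y') \<longleftrightarrow>
        v = v' \<and> x = x' \<and> adj X\<^sub>2 y y' \<or> v = v' \<and> adj X\<^sub>1 x x' \<and> y = y' \<or>
        adj \<Gamma>' v v' \<and> f v = f v' \<and> x = x' \<and> y = y' \<or>
        adj \<Gamma>' v v' \<and> adj \<Gamma> (f v) (f v') \<and> adj X\<^sub>1 x x' \<and> adj X\<^sub>2 y y'"
      using that irrefl m(4,5,9,10) unfolding aL vL[symmetric] Pair_inject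
      by (cases "v = v'"; cases "f v = f v'") auto
    moreover have "adj Y1 (v, x) (v', x') \<longleftrightarrow> v = v' \<and> adj X\<^sub>1 x x' \<or>
        adj \<Gamma>' v v' \<and> f v = f v' \<and> x = x' \<or> adj \<Gamma>' v v' \<and> adj \<Gamma> (f v) (f v') \<and> adj X\<^sub>1 x x'"
      unfolding aY1 by (simp add: m)
    moreover have "adj Y2 (v, y) (v', y') \<longleftrightarrow> v = v' \<and> adj X\<^sub>2 y y' \<or>
        adj \<Gamma>' v v' \<and> f v = f v' \<and> y = y' \<or> adj \<Gamma>' v v' \<and> adj \<Gamma> (f v) (f v') \<and> adj X\<^sub>2 y y'"
      unfolding aY2 by (simp add: m)
    moreover have "adj R ((v, x), (v, y)) ((v', x'), (v', y')) \<longleftrightarrow>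
        (v, x) = (v', x') \<and> adj Y2 (v, y) (v', y') \<or>
        adj Y1 (v, x) (v', x') \<and> v = v' \<and> (v, y) = (v', y') \<or>
        adj Y1 (v, x) (v', x') \<and> adj \<Gamma>' v v' \<and> adj Y2 (v, y) (v', y')"
      unfolding aR by (simp add: vY1 vY2 m)
    \<comment> \<open>For \<open>v = v'\<close> only (I) is possible in \<open>Y1\<close> and
      \<open>Y2\<close>, giving the first two alternatives. For adjacent \<open>v\<close> and
      \<open>v'\<close>, both use (II) or both use (III), according to whether \<open>f\<close>
      contracts the edge, giving the last two.\<close>
    ultimately show ?thesis
      using irrefl m(4,5,9,10) by (cases "v = v'"; cases "f v = f v'") auto
  qed
  ultimately have "graph_iso \<Phi> L R"
    using fiber_bundleD(3)[OF bL] fiber_bundleD(3)[OF bR] by (auto simp: graph_iso_def \<Phi>_def)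
  moreover have "\<forall>a\<in>verts L. r (\<Phi> a) = fst a" by (auto simp: r_def \<Phi>_def)
  ultimately show ?thesis
    unfolding sub lhs Y1 Y2 rhs bundle_equivalent.simps
    using fiber_bundle_imp_graph_bundle[OF bL] fiber_bundle_imp_graph_bundle[OF bR] by blast
qed

end
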